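(* Let $C$ be a nontrivial cyclic group (finite or infinite), and let $G$ be a finitely generated group that contains (an isomorphic copy of) $\mathbb{Z}^2\times C$ as a subgroup. Then for every finite symmetric generating set $S$ of $G$ not containing the identity, the Cayley graph $\mathrm{Cay}(G,S)$ is not minor excluded.
   Context: Cayley graph: for a group $G$ and a finite generating set $S$ that is symmetric ($s\in S$ iff $s^{-1}\in S$) and does not contain the identity, $\mathrm{Cay}(G,S)$ is the graph with vertex set $G$ in which $u,v\in G$ are adjacent if and only if $u=sv$ for some $s\in S$. Minor: a finite graph $M$ is a minor of a connected graph $\Gamma$ if there is a finite set $\{V_i\}$ of pairwise-disjoint (nonempty) finite connected subgraphs of $\Gamma$ (branch sets), in one-to-one correspondence with the set of vertices $\{v_i\}$ of $M$, such that for every edge of $M$ between $v_i$ and $v_j$ there is an edge of $\Gamma$ between $V_i$ and $V_j$. The graph $\Gamma$ is minor excluded if there is a finite graph that is not a minor of $\Gamma$; equivalently, if there is a natural number $m$ such that the complete graph $K_m$ is not a minor of $\Gamma$. *)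

theory Defs
  imports
    "HOL-Algebra.Elementary_Groups"
    "HOL-Library.Disjoint_Sets"
    "Graph_Theory.Graph_Theory"
begin

text \<open>
  Simple undirected graphs, possibly infinite, are symmetric loop-free \<^typ>\<open>'a pair_pre_digraph\<close>s
  (locale \<^locale>\<open>pair_bidirected_digraph\<close>); an undirected edge is a pair of opposite arcs.
  Finite ones form the locale \<^locale>\<open>pair_graph\<close>.
\<close>

definition cayley_graph :: "('a, 'b) monoid_scheme \<Rightarrow> 'a set \<Rightarrow> 'a pair_pre_digraph" where
  "cayley_graph G S =
    \<lparr>pverts = carrier G,
     parcs = {(u, v). u \<in> carrier G \<and> v \<in> carrier G \<and> (\<exists>s\<in>S. u = s \<otimes>\<^bsub>G\<^esub> v)}\<rparr>"

definition finitely_generated_group :: "('a, 'b) monoid_scheme \<Rightarrow> bool" where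
  "finitely_generated_group G \<longleftrightarrow>
    group G \<and> (\<exists>X. finite X \<and> X \<subseteq> carrier G \<and> generate G X = carrier G)"

text \<open>
  \<open>B v\<close> is the branch set of the vertex \<open>v\<close>. Nonemptiness of branch sets is part of
  \<^const>\<open>connected\<close>. Being a \<^const>\<open>pair_graph\<close> makes a branch set a finite undirected graph
  (a subgraph in the sense of \<^const>\<open>subgraph\<close> need not be symmetric).
\<close>

definition is_minor :: "'v pair_pre_digraph \<Rightarrow> 'a pair_pre_digraph \<Rightarrow> bool" where
  "is_minor M \<Gamma> \<longleftrightarrow>
    (\<exists>B :: 'v \<Rightarrow> 'a pair_pre_digraph.
      (\<forall>v\<in>pverts M. pair_graph (B v) \<and> subgraph (with_proj (B v)) (with_proj \<Gamma>)
                      \<and> connected (with_proj (B v))) \<and>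
      disjoint_family_on (\<lambda>v. pverts (B v)) (pverts M) \<and>
      (\<forall>(u, v)\<in>parcs M. \<exists>x\<in>pverts (B u). \<exists>y\<in>pverts (B v). (x, y) \<in> parcs \<Gamma>))"

text \<open>
  Every finite graph is isomorphic to one whose vertices are natural numbers, so the quantifier
  ranges over all finite graphs up to isomorphism.
\<close>

definition minor_excluded :: "'a pair_pre_digraph \<Rightarrow> bool" where
  "minor_excluded \<Gamma> \<longleftrightarrow>
    (\<exists>M :: nat pair_pre_digraph. pair_graph M \<and> \<not> is_minor M \<Gamma>)"

end

theory Submission
  imports Defs
begin

text \<open>
  Right multiplication by \<open>a\<^sup>i b\<^sup>j c\<^sup>k\<close>, with \<open>a\<close>, \<open>b\<close> a basis of \<open>\<int>\<^sup>2\<close> and \<open>1 \<noteq> c \<in> C\<close>, is an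
  action of \<open>\<int>\<^sup>3\<close> by automorphisms of the Cayley graph.

  A shortest walk from some \<open>v\<close> to some \<open>v a\<^sup>n c\<^sup>k\<close> with \<open>n \<noteq> 0\<close> has a periodic continuation \<open>H\<close> that is
  disjoint from \<open>H c\<close>. Call the sets \<open>H b\<^sup>N\<^sup>j c\<^sup>k\<close>, with \<open>N\<close> large, tracks of level \<open>j\<close>; tracks of different
  levels are disjoint. A shortest walk between tracks of different levels meets the tracks only in its
  endpoints, which up to translation lie in \<open>H\<close> and in \<open>H t\<close> with \<open>t = b\<^sup>N\<^sup>d c\<^sup>k\<close>. Joined inside the
  sets \<open>H t\<^sup>j\<close>, its \<open>t\<close>-translates form a vertical line \<open>W\<close> that crosses every level but
  avoids all \<open>H c t\<^sup>j\<close>. Hence the widely spaced translates of \<open>H c\<close> and \<open>W\<close> form a grid of horizontal and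
  vertical lines that do not meet, although they come boundedly close at every crossing. Letting the
  \<open>i\<close>-th branch set be the \<open>i\<close>-th horizontal line joined to the \<open>i\<close>-th vertical line gives every
  complete minor.
\<close>

section \<open>Connectedness inside a set of vertices\<close>

text \<open>Branch sets are treated as bare vertex sets, possibly infinite; finite induced subgraphs
  are formed only in \<open>is_minor_if_adjacent_conn_on\<close>. The empty set counts as connected,
  so nonemptiness is tracked separately.\<close>

definition conn_on :: "'a rel \<Rightarrow> 'a set \<Rightarrow> bool" where
  "conn_on E X \<longleftrightarrow> (\<forall>x\<in>X. \<forall>y\<in>X. (x, y) \<in> rtrancl_on X E)"

lemma conn_onD: "conn_on E X \<Longrightarrow> x \<in> X \<Longrightarrow> y \<in> X \<Longrightarrow> (x, y) \<in> rtrancl_on X E"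
  by (simp add: conn_on_def)

lemma conn_on_supsetD:
  "conn_on E X \<Longrightarrow> x \<in> X \<Longrightarrow> y \<in> X \<Longrightarrow> X \<subseteq> Y \<Longrightarrow> (x, y) \<in> rtrancl_on Y E"
  using rtrancl_on_mono[OF subset_refl] conn_onD by metis

lemma rtrancl_on_flip: "sym E \<Longrightarrow> (x, y) \<in> rtrancl_on X E \<Longrightarrow> (y, x) \<in> rtrancl_on X E"
  by (meson rtrancl_on_sym symD)

lemma conn_on_singleton: "conn_on E {x}"
  by (auto simp: conn_on_def)

lemma conn_on_Union:
  assumes "\<And>X. X \<in> \<X> \<Longrightarrow> conn_on E X" and "\<And>X. X \<in> \<X> \<Longrightarrow> x \<in> X"
  shows "conn_on E (\<Union>\<X>)"
  unfolding conn_on_def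
proof (intro ballI)
  fix y z assume "y \<in> \<Union>\<X>" "z \<in> \<Union>\<X>"
  then obtain Y Z where YZ: "Y \<in> \<X>" "Z \<in> \<X>" "y \<in> Y" "z \<in> Z" by blast
  have "(y, x) \<in> rtrancl_on (\<Union>\<X>) E"
    using conn_on_supsetD[OF assms(1)] assms(2) YZ by blast
  moreover have "(x, z) \<in> rtrancl_on (\<Union>\<X>) E"
    using conn_on_supsetD[OF assms(1)] assms(2) YZ by blast
  ultimately show "(y, z) \<in> rtrancl_on (\<Union>\<X>) E" by (rule rtrancl_on_trans)
qed

lemma conn_on_Un:
  assumes "conn_on E X" "conn_on E Y" "X \<inter> Y \<noteq> {}"
  shows "conn_on E (X \<union> Y)"
proof -
  obtain x where "x \<in> X" "x \<in> Y" using assms(3) by blast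
  with conn_on_Union[of "{X, Y}" E x] assms(1,2) show ?thesis by auto
qed

lemma conn_on_edge: "sym E \<Longrightarrow> (x, y) \<in> E \<Longrightarrow> conn_on E {x, y}"
  unfolding conn_on_def
  by (auto intro: rtrancl_on_into_rtrancl_on[OF rtrancl_on_refl] dest: symD)

lemma conn_on_walk:
  assumes "sym E" "\<And>i. i < n \<Longrightarrow> (f i, f (Suc i)) \<in> E"
  shows "conn_on E (f ` {..n})"
  using assms(2)
proof (induction n)
  case 0
  then show ?case by (simp add: conn_on_singleton)
next
  case (Suc n)
  have "conn_on E (f ` {..n} \<union> {f n, f (Suc n)})"
    using Suc conn_on_edge[OF assms(1)] by (intro conn_on_Un) auto
  also have "f ` {..n} \<union> {f n, f (Suc n)} = f ` {..Suc n}"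
    by (auto simp: atMost_Suc)
  finally show ?case .
qed

text \<open>The chain is infinite in both directions, as needed for lines built from all translates
  of one finite piece.\<close>

lemma conn_on_chain:
  fixes Y :: "int \<Rightarrow> 'a set"
  assumes "sym E" "\<And>i. conn_on E (Y i)" "\<And>i. Y i \<inter> Y (i + 1) \<noteq> {}"
  shows "conn_on E (\<Union>i. Y i)"
proof -
  let ?U = "\<Union>i. Y i"
  have up: "\<forall>y\<in>Y j. (x, y) \<in> rtrancl_on ?U E" if "x \<in> Y i" "i \<le> j" for x i j
    using that(2)
  proof (induction j rule: int_ge_induct)
    case base
    show ?case
      using conn_on_supsetD[OF assms(2)] that(1) by blast
  next
    case (step j)
    obtain z where z: "z \<in> Y j" "z \<in> Y (j + 1)" using assms(3) by blast
    have "(z, y) \<in> rtrancl_on ?U E" if "y \<in> Y (j + 1)" for y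
      using conn_on_supsetD[OF assms(2)] that z(2) by blast
    then show ?case using step.IH z(1) by (blast intro: rtrancl_on_trans)
  qed
  show ?thesis
    unfolding conn_on_def
  proof (intro ballI)
    fix x y assume "x \<in> ?U" "y \<in> ?U"
    then obtain i j where "x \<in> Y i" "y \<in> Y j" by blast
    then show "(x, y) \<in> rtrancl_on ?U E"
      using up[of x i j] up[of y j i] rtrancl_on_flip[OF assms(1), of y x] by (cases "i \<le> j") auto
  qed
qed

lemma rtrancl_on_finite_conn_on:
  assumes "sym E" "(x, y) \<in> rtrancl_on X E"
  shows "\<exists>P. finite P \<and> P \<subseteq> X \<and> x \<in> P \<and> y \<in> P \<and> conn_on E P"
  using assms(2)
proof (induction rule: rtrancl_on_induct)
  case base
  then show ?case by (intro exI[of _ "{x}"]) (auto simp: conn_on_singleton)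
next
  case (step y z)
  then obtain P where P: "finite P" "P \<subseteq> X" "x \<in> P" "y \<in> P" "conn_on E P" by blast
  have "conn_on E (P \<union> {y, z})"
    using P conn_on_edge[OF assms(1) step.hyps(2)] by (intro conn_on_Un) auto
  then show ?case using P step.hyps by (intro exI[of _ "P \<union> {y, z}"]) auto
qed

text \<open>Finite connected pieces joining one base point to each point of \<open>F\<close> are
  united; the base point keeps the result nonempty even for empty \<open>F\<close>. This cuts
  infinite branch sets down to finite ones.\<close>

lemma conn_on_finite_subset:
  assumes "sym E" "conn_on E X" "finite F" "F \<subseteq> X" "X \<noteq> {}"
  shows "\<exists>Z. finite Z \<and> F \<subseteq> Z \<and> Z \<subseteq> X \<and> Z \<noteq> {} \<and> conn_on E Z"
proof -
  obtain x where x: "x \<in> X" using assms(5) by blast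
  have "\<exists>P. finite P \<and> P \<subseteq> X \<and> x \<in> P \<and> y \<in> P \<and> conn_on E P" if "y \<in> insert x F" for y
    using rtrancl_on_finite_conn_on[OF assms(1) conn_onD[OF assms(2) x]] that x assms(4) by blast
  then obtain P where P: "\<And>y. y \<in> insert x F \<Longrightarrow>
      finite (P y) \<and> P y \<subseteq> X \<and> x \<in> P y \<and> y \<in> P y \<and> conn_on E (P y)"
    by metis
  have "conn_on E (\<Union>(P ` insert x F))"
    by (rule conn_on_Union[where x = x]) (use P in blast)+
  moreover have "finite (\<Union>(P ` insert x F))" using P assms(3) by blast
  moreover have "F \<subseteq> \<Union>(P ` insert x F)" "\<Union>(P ` insert x F) \<subseteq> X" "x \<in> \<Union>(P ` insert x F)"
    using P by blast+
  ultimately show ?thesis by blast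
qed

text \<open>The set \<open>A'\<close> consists of the points that can be reached from \<open>A\<close> inside \<open>A \<union> R\<close> without entering \<open>B\<close>.\<close>

lemma conn_on_extend:
  assumes "sym E" "conn_on E A" "conn_on E R" "A \<inter> R \<noteq> {}" "R \<inter> B \<noteq> {}" "A \<inter> B = {}"
  shows "\<exists>A'. A \<subseteq> A' \<and> A' \<subseteq> A \<union> R \<and> conn_on E A' \<and> A' \<inter> B = {} \<and> (\<exists>x\<in>A'. \<exists>y\<in>B. (x, y) \<in> E)"
proof -
  obtain a where a: "a \<in> A" "a \<in> R" using assms(4) by blast
  obtain b where b: "b \<in> R" "b \<in> B" using assms(5) by blast
  define \<P> where "\<P> = {P. a \<in> P \<and> P \<subseteq> (A \<union> R) - B \<and> conn_on E P}"
  have A: "A \<in> \<P>" using a assms(2,6) by (auto simp: \<P>_def)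
  have conn: "conn_on E (\<Union>\<P>)"
    by (rule conn_on_Union[where x = a]) (auto simp: \<P>_def)
  \<comment> \<open>Induction along a walk in \<open>R\<close> from \<open>a\<close>: as long as no
    edge from \<open>\<Union>\<P>\<close> into \<open>B\<close> has been found, the walk is still in
    \<open>\<Union>\<P>\<close>. It ends at \<open>b\<close> in \<open>B\<close>, which
    \<open>\<Union>\<P>\<close> avoids, so such an edge exists.\<close>
  have "(\<exists>x\<in>\<Union>\<P>. \<exists>y\<in>B. (x, y) \<in> E) \<or> y \<in> \<Union>\<P>" if "(a, y) \<in> rtrancl_on R E" for y
    using that
  proof (induction rule: rtrancl_on_induct)
    case base
    then show ?case using A a by blast
  next
    case (step y z)
    show ?case
    proof (cases "z \<in> B \<or> (\<exists>x\<in>\<Union>\<P>. \<exists>y\<in>B. (x, y) \<in> E)")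
      case True
      then show ?thesis using step by blast
    next
      case False
      then have y: "y \<in> \<Union>\<P>" using step by blast
      have "conn_on E (\<Union>\<P> \<union> {y, z})"
        using conn conn_on_edge[OF assms(1) step.hyps(2)] y by (intro conn_on_Un) auto
      then have "\<Union>\<P> \<union> {y, z} \<in> \<P>"
        using A a(1) step.hyps y False by (auto simp: \<P>_def)
      then show ?thesis by blast
    qed
  qed
  from this[OF conn_onD[OF assms(3) a(2) b(1)]] have "\<exists>x\<in>\<Union>\<P>. \<exists>y\<in>B. (x, y) \<in> E"
    using b(2) by (auto simp: \<P>_def)
  then show ?thesis
    using A conn by (intro exI[of _ "\<Union>\<P>"]) (auto simp: \<P>_def)
qed

section \<open>Minors from disjoint connected sets\<close>

text \<open>Since \<open>M\<close> is finite, only finitely many points of each \<open>B i\<close>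
  are endpoints of the chosen linking arcs, and a finite connected subset of \<open>B i\<close>
  containing them can serve as branch set.\<close>

lemma is_minor_if_adjacent_conn_on:
  fixes M :: "nat pair_pre_digraph" and B :: "nat \<Rightarrow> 'a set"
  assumes "pair_bidirected_digraph \<Gamma>" and M: "pair_graph M"
    and B: "\<And>i. conn_on (parcs \<Gamma>) (B i)" "\<And>i. B i \<noteq> {}" "\<And>i. B i \<subseteq> pverts \<Gamma>"
    and disj: "\<And>i j. i \<noteq> j \<Longrightarrow> B i \<inter> B j = {}"
    and adj: "\<And>i j. i < j \<Longrightarrow> \<exists>x\<in>B i. \<exists>y\<in>B j. (x, y) \<in> parcs \<Gamma>"
  shows "is_minor M \<Gamma>"
proof -
  interpret \<Gamma>: pair_bidirected_digraph \<Gamma> by fact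
  interpret M: pair_graph M by fact
  have sym: "sym (parcs \<Gamma>)" using \<Gamma>.pair_sym_arcs by (simp add: symmetric_def)
  have arc_sym: "(y, x) \<in> parcs \<Gamma>" if "(x, y) \<in> parcs \<Gamma>" for x y using sym that by (rule symD)
  have "\<exists>x y. x \<in> B i \<and> y \<in> B j \<and> (x, y) \<in> parcs \<Gamma>" if "i \<noteq> j" for i j
    using adj[of i j] adj[of j i] that arc_sym by (cases "i < j") (simp, blast, simp, blast)
  then have "\<forall>i j. \<exists>x y. i \<noteq> j \<longrightarrow> x \<in> B i \<and> y \<in> B j \<and> (x, y) \<in> parcs \<Gamma>"
    by blast
  then obtain p q where pq: "\<And>i j. i \<noteq> j \<Longrightarrow> p i j \<in> B i \<and> q i j \<in> B j \<and> (p i j, q i j) \<in> parcs \<Gamma>"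
    unfolding choice_iff by blast
  \<comment> \<open>Arcs are chosen for ordered pairs, so set \<open>i\<close> must keep the tail of
    the arc for \<open>(i, j)\<close> and the head of the arc for \<open>(j, i)\<close>.\<close>
  define F where "F i = (\<Union>j\<in>pverts M - {i}. {p i j, q j i})" for i
  have "\<exists>Z. finite Z \<and> F i \<subseteq> Z \<and> Z \<subseteq> B i \<and> Z \<noteq> {} \<and> conn_on (parcs \<Gamma>) Z" for i
  proof (intro conn_on_finite_subset sym B)
    show "finite (F i)" using M.pair_finite_verts by (simp add: F_def)
    show "F i \<subseteq> B i"
    proof
      fix x assume "x \<in> F i"
      then obtain j where "j \<noteq> i" "x = p i j \<or> x = q j i" unfolding F_def by blast
      then show "x \<in> B i" using pq[of i j] pq[of j i] by auto
    qed
  qed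
  then have "\<forall>i. \<exists>Z. finite Z \<and> F i \<subseteq> Z \<and> Z \<subseteq> B i \<and> Z \<noteq> {} \<and> conn_on (parcs \<Gamma>) Z"
    by blast
  then obtain Z where Z: "\<And>i. finite (Z i)" "\<And>i. F i \<subseteq> Z i" "\<And>i. Z i \<subseteq> B i" "\<And>i. Z i \<noteq> {}"
      "\<And>i. conn_on (parcs \<Gamma>) (Z i)"
    unfolding choice_iff by blast
  define X where "X i = \<lparr>pverts = Z i, parcs = parcs \<Gamma> \<inter> Z i \<times> Z i\<rparr>" for i
  have X: "pair_graph (X i)" for i
  proof
    show "symmetric (with_proj (X i))"
      using arc_sym by (auto simp: X_def symmetric_def intro: symI)
  qed (use Z(1) \<Gamma>.pair_no_loops in \<open>auto simp: X_def\<close>)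
  \<comment> \<open>\<open>connected\<close> is defined through the symmetric closure, which adds
    nothing to the already symmetric \<open>X i\<close>.\<close>
  have mk: "parcs (mk_symmetric (with_proj (X i))) = parcs \<Gamma> \<inter> Z i \<times> Z i" for i
    using arc_sym by (auto simp: parcs_mk_symmetric X_def)
  show ?thesis
    unfolding is_minor_def
  proof (intro exI[of _ X] conjI ballI)
    fix v
    show "pair_graph (X v)" by (rule X)
    interpret Xv: pair_graph "X v" by (rule X)
    show "subgraph (with_proj (X v)) (with_proj \<Gamma>)"
      unfolding subgraph_def compatible_def
      using subset_trans[OF Z(3) B(3)] \<Gamma>.wf_digraph_axioms Xv.wf_digraph_axioms
      by (simp add: X_def)
    have "(x, y) \<in> rtrancl_on (Z v) (parcs \<Gamma> \<inter> Z v \<times> Z v)" if "x \<in> Z v" "y \<in> Z v" for x y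
      using conn_onD[OF Z(5) that]
    proof (induction rule: rtrancl_on_induct)
      case (step y z)
      then show ?case by (intro rtrancl_on_into_rtrancl_on[OF step.IH]) auto
    qed simp
    moreover have "pverts (X v) = Z v" by (simp add: X_def)
    ultimately show "connected (with_proj (X v))"
      using Z(4) by (simp add: connected_def strongly_connected_def reachable_def mk)
  next
    show "disjoint_family_on (\<lambda>v. pverts (X v)) (pverts M)"
      unfolding disjoint_family_on_def X_def using disj Z(3) by (simp, blast)
  next
    fix e assume e: "e \<in> parcs M"
    obtain u v where uv: "e = (u, v)" by (cases e)
    have "u \<noteq> v" "u \<in> pverts M" "v \<in> pverts M"
      using M.pair_no_loops[OF e] M.wellformed[OF e] uv by auto
    then have "p u v \<in> F u" "q u v \<in> F v" by (auto simp: F_def)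
    then have "p u v \<in> Z u" "q u v \<in> Z v" using Z(2) by blast+
    then show "case e of (u, v) \<Rightarrow> \<exists>x\<in>pverts (X u). \<exists>y\<in>pverts (X v). (x, y) \<in> parcs \<Gamma>"
      using pq[OF \<open>u \<noteq> v\<close>] uv by (auto simp: X_def)
  qed
qed

text \<open>For \<open>i < j\<close>, the set \<open>B i\<close> absorbs the part of the link
  \<open>R i j\<close> that is reachable without entering \<open>B j\<close>. The enlarged sets stay
  disjoint and are joined by single edges.\<close>

lemma is_minor_if_linked_conn_on:
  fixes M :: "nat pair_pre_digraph" and B :: "nat \<Rightarrow> 'a set" and R :: "nat \<Rightarrow> nat \<Rightarrow> 'a set"
  assumes \<Gamma>: "pair_bidirected_digraph \<Gamma>" and M: "pair_graph M"
    and B: "\<And>i. conn_on (parcs \<Gamma>) (B i)" "\<And>i. B i \<noteq> {}" "\<And>i. B i \<subseteq> pverts \<Gamma>"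
    and R: "\<And>i j. i < j \<Longrightarrow> conn_on (parcs \<Gamma>) (R i j)" "\<And>i j. i < j \<Longrightarrow> R i j \<subseteq> pverts \<Gamma>"
    and meet: "\<And>i j. i < j \<Longrightarrow> B i \<inter> R i j \<noteq> {}" "\<And>i j. i < j \<Longrightarrow> R i j \<inter> B j \<noteq> {}"
    and disjB: "\<And>i j. i \<noteq> j \<Longrightarrow> B i \<inter> B j = {}"
    and disjBR: "\<And>i j k. i < j \<Longrightarrow> k \<noteq> i \<Longrightarrow> k \<noteq> j \<Longrightarrow> R i j \<inter> B k = {}"
    and disjR: "\<And>i j k l. i < j \<Longrightarrow> k < l \<Longrightarrow> (i, j) \<noteq> (k, l) \<Longrightarrow> R i j \<inter> R k l = {}"
  shows "is_minor M \<Gamma>"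
proof -
  interpret \<Gamma>: pair_bidirected_digraph \<Gamma> by fact
  have sym: "sym (parcs \<Gamma>)" using \<Gamma>.pair_sym_arcs by (simp add: symmetric_def)
  have "\<exists>A'. B i \<subseteq> A' \<and> A' \<subseteq> B i \<union> R i j \<and> conn_on (parcs \<Gamma>) A' \<and> A' \<inter> B j = {} \<and>
      (\<exists>x\<in>A'. \<exists>y\<in>B j. (x, y) \<in> parcs \<Gamma>)" if "i < j" for i j
    by (rule conn_on_extend[OF sym B(1) R(1)[OF that] meet(1)[OF that] meet(2)[OF that]
      disjB[OF less_imp_neq[OF that]]])
  then have "\<forall>i j. \<exists>A'. i < j \<longrightarrow> B i \<subseteq> A' \<and> A' \<subseteq> B i \<union> R i j \<and> conn_on (parcs \<Gamma>) A' \<and>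
      A' \<inter> B j = {} \<and> (\<exists>x\<in>A'. \<exists>y\<in>B j. (x, y) \<in> parcs \<Gamma>)"
    by simp
  then obtain A where A_all: "\<forall>i j. i < j \<longrightarrow> B i \<subseteq> A i j \<and> A i j \<subseteq> B i \<union> R i j \<and>
      conn_on (parcs \<Gamma>) (A i j) \<and> A i j \<inter> B j = {} \<and> (\<exists>x\<in>A i j. \<exists>y\<in>B j. (x, y) \<in> parcs \<Gamma>)"
    unfolding choice_iff by (elim exE)
  then have A: "\<And>i j. i < j \<Longrightarrow> B i \<subseteq> A i j" "\<And>i j. i < j \<Longrightarrow> A i j \<subseteq> B i \<union> R i j"
      "\<And>i j. i < j \<Longrightarrow> conn_on (parcs \<Gamma>) (A i j)" "\<And>i j. i < j \<Longrightarrow> A i j \<inter> B j = {}"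
      "\<And>i j. i < j \<Longrightarrow> \<exists>x\<in>A i j. \<exists>y\<in>B j. (x, y) \<in> parcs \<Gamma>"
    by simp_all
  define B' where "B' i = \<Union>(A i ` {i<..})" for i
  \<comment> \<open>The index \<open>Suc i\<close> witnesses that the union defining
    \<open>B' i\<close> is not empty.\<close>
  have B'_B: "B i \<subseteq> B' i" for i
    using A(1)[of i "Suc i"] unfolding B'_def by blast
  have disj: "B' i \<inter> B' k = {}" if "i < k" for i k
  proof -
    have "A i j \<inter> A k l = {}" if "i < j" "k < l" for j l
    proof -
      have "R i j \<inter> R k l = {}" "B i \<inter> B k = {}" "B i \<inter> R k l = {}"
        using disjR[of i j k l] disjB[of i k] disjBR[of k l i] that \<open>i < k\<close> by auto
      \<comment> \<open>The link \<open>R i j\<close> may meet \<open>B k\<close> only for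
        \<open>k = j\<close>, and \<open>A i j\<close> was cut off before entering
        \<open>B j\<close>.\<close>
      moreover have "A i j \<inter> B k = {}"
      proof (cases "k = j")
        case True then show ?thesis using A(4) that by blast
      next
        case False
        then have "R i j \<inter> B k = {}" "B i \<inter> B k = {}"
          using disjBR[of i j k] disjB[of i k] that \<open>i < k\<close> by auto
        then show ?thesis using A(2)[OF that(1)] by blast
      qed
      ultimately show ?thesis using A(2)[OF that(1)] A(2)[OF that(2)] by blast
    qed
    then show ?thesis unfolding B'_def by blast
  qed
  show ?thesis
  proof (rule is_minor_if_adjacent_conn_on[OF \<Gamma> M])
    fix i
    obtain x where x: "x \<in> B i" using B(2) by blast
    show "conn_on (parcs \<Gamma>) (B' i)"
      unfolding B'_def by (rule conn_on_Union[where x = x]) (use A(1,3) x in blast)+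
    show "B' i \<noteq> {}" using x B'_B by blast
    show "B' i \<subseteq> pverts \<Gamma>" using A(2) B(3) R(2) unfolding B'_def by blast
  next
    fix i j :: nat assume "i \<noteq> j"
    then show "B' i \<inter> B' j = {}" using disj[of i j] disj[of j i] by (cases "i < j") auto
  next
    fix i j :: nat assume ij: "i < j"
    then have "A i j \<subseteq> B' i" by (auto simp: B'_def)
    then show "\<exists>x\<in>B' i. \<exists>y\<in>B' j. (x, y) \<in> parcs \<Gamma>" using A(5)[OF ij] B'_B[of j] by blast
  qed
qed


section \<open>Graphs with an action of the lattice\<close>

lemma relpow_subwalk:
  assumes "\<forall>m<n. (f m, f (Suc m)) \<in> E" "s \<le> t" "t \<le> n"
  shows "(f s, f t) \<in> E ^^ (t - s)"
  unfolding relpow_fun_conv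
  by (intro exI[of _ "\<lambda>m. f (s + m)"]) (use assms in auto)

text \<open>
  The action of \<open>\<int>\<^sup>3\<close> need not be free in the third coordinate, so that the third coordinate may
  act through a finite cyclic group.
\<close>

locale lattice_graph =
  fixes \<Gamma> :: "'a pair_pre_digraph" and act :: "int \<Rightarrow> int \<Rightarrow> int \<Rightarrow> 'a \<Rightarrow> 'a"
  assumes graph: "pair_bidirected_digraph \<Gamma>"
    and conn: "conn_on (parcs \<Gamma>) (pverts \<Gamma>)"
    and nonempty: "pverts \<Gamma> \<noteq> {}"
    and act_in: "x \<in> pverts \<Gamma> \<Longrightarrow> act i j k x \<in> pverts \<Gamma>"
    and act_0: "act 0 0 0 x = x"
    and act_act: "act i j k (act i' j' k' x) = act (i + i') (j + j') (k + k') x"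
    and act_edge: "(x, y) \<in> parcs \<Gamma> \<Longrightarrow> (act i j k x, act i j k y) \<in> parcs \<Gamma>"
    and free: "x \<in> pverts \<Gamma> \<Longrightarrow> act i j k x = x \<Longrightarrow> i = 0 \<and> j = 0"
begin

abbreviation "V \<equiv> pverts \<Gamma>"
abbreviation "E \<equiv> parcs \<Gamma>"

lemma sym_E: "sym E"
  using graph by (simp add: pair_bidirected_digraph_def pair_sym_digraph_def
      pair_sym_digraph_axioms_def symmetric_def)

lemma act_eq_iff: "act i j k x = act i' j' k' y \<longleftrightarrow> act (i - i') (j - j') (k - k') x = y"
proof
  assume "act i j k x = act i' j' k' y"
  then have "act (- i') (- j') (- k') (act i j k x) = act (- i') (- j') (- k') (act i' j' k' y)"
    by simp
  then show "act (i - i') (j - j') (k - k') x = y"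
    by (simp add: act_act act_0)
next
  assume "act (i - i') (j - j') (k - k') x = y"
  then show "act i j k x = act i' j' k' y"
    by (auto simp: act_act)
qed

lemma free_coords_unique:
  assumes "x \<in> V" "act i j k x = act i' j' k' x"
  shows "i = i' \<and> j = j'"
proof -
  have "act (i - i') (j - j') (k - k') x = x" using assms(2) by (simp add: act_eq_iff)
  with free[OF assms(1)] show ?thesis by force
qed

text \<open>Restricts the action to the sublattice spanned by \<open>(p, 0, r)\<close>,
  \<open>(0, q, s)\<close> and \<open>(0, 0, 1)\<close>. Periods of lines can thereby be made unit
  vectors, and levels be spaced widely.\<close>

lemma lattice_graph_reparametrise:
  assumes "p \<noteq> 0" "q \<noteq> 0"
  shows "lattice_graph \<Gamma> (\<lambda>i j k. act (p * i) (q * j) (k + r * i + s * j))"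
proof (rule lattice_graph.intro[OF graph conn nonempty])
  fix x i j k assume "x \<in> V" "act (p * i) (q * j) (k + r * i + s * j) x = x"
  then show "i = 0 \<and> j = 0" using free[of x "p * i" "q * j"] assms by simp
qed (simp_all add: act_in act_0 act_edge act_act algebra_simps)

lemma conn_on_act_image:
  assumes "conn_on E X"
  shows "conn_on E (act i j k ` X)"
  unfolding conn_on_def
proof (intro ballI)
  fix x' y' assume "x' \<in> act i j k ` X" "y' \<in> act i j k ` X"
  then obtain x y where xy: "x \<in> X" "y \<in> X" "x' = act i j k x" "y' = act i j k y" by blast
  have "(act i j k x, act i j k y) \<in> rtrancl_on (act i j k ` X) E"
    using conn_onD[OF assms xy(1,2)]
  proof (induction rule: rtrancl_on_induct)
    case (step y z)
    then show ?case by (intro rtrancl_on_into_rtrancl_on[OF step.IH] act_edge imageI)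
  qed simp
  then show "(x', y') \<in> rtrancl_on (act i j k ` X) E" using xy by simp
qed

text \<open>By freeness each pair of points admits at most one \<open>(i, j)\<close>, whatever
  \<open>k\<close> is, and there are finitely many pairs. So translates of a finite set that lie
  \<open>N\<close> apart in one of the first two coordinates are disjoint.\<close>

lemma displacement_bound:
  assumes "finite F" "F \<subseteq> V"
  shows "\<exists>N>0. \<forall>x\<in>F. \<forall>y\<in>F. \<forall>i j k. act i j k x = y \<longrightarrow> \<bar>i\<bar> < N \<and> \<bar>j\<bar> < N"
proof -
  have "\<exists>n. \<forall>i j k. act i j k x = y \<longrightarrow> \<bar>i\<bar> < n \<and> \<bar>j\<bar> < n" if "x \<in> F" for x y
  proof (cases "\<exists>i j k. act i j k x = y")
    case True
    then obtain i j k where "act i j k x = y" by blast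
    then have "i' = i \<and> j' = j" if "act i' j' k' x = y" for i' j' k'
      using free_coords_unique[of x i' j' k' i j k] that \<open>x \<in> F\<close> assms(2) by auto
    then show ?thesis
      by (intro exI[of _ "\<bar>i\<bar> + \<bar>j\<bar> + 1"]) fastforce
  qed simp
  then have "\<forall>x y. \<exists>n. x \<in> F \<longrightarrow> (\<forall>i j k. act i j k x = y \<longrightarrow> \<bar>i\<bar> < n \<and> \<bar>j\<bar> < n)"
    by simp
  then obtain n where n:
      "\<forall>x y. x \<in> F \<longrightarrow> (\<forall>i j k. act i j k x = y \<longrightarrow> \<bar>i\<bar> < n x y \<and> \<bar>j\<bar> < n x y)"
    unfolding choice_iff by (elim exE)
  define N where "N = Max (insert 1 ((\<lambda>(x, y). n x y) ` (F \<times> F)))"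
  have fin: "finite (insert 1 ((\<lambda>(x, y). n x y) ` (F \<times> F)))" using assms(1) by simp
  have "n x y \<le> N" if "x \<in> F" "y \<in> F" for x y
    unfolding N_def using that by (intro Max_ge[OF fin]) auto
  moreover have "1 \<le> N" unfolding N_def by (rule Max_ge[OF fin]) simp
  ultimately have "0 < N \<and> (\<forall>x\<in>F. \<forall>y\<in>F. \<forall>i j k. act i j k x = y \<longrightarrow> \<bar>i\<bar> < N \<and> \<bar>j\<bar> < N)"
    using n by (meson less_le_trans zero_less_one)
  then show ?thesis by blast
qed

section \<open>The grid of horizontal and vertical lines\<close>

text \<open>Widely spaced translates of \<open>H\<close> and \<open>W\<close> form a grid, with
  copies of a finite bridge \<open>R\<close> at the crossings. The covering by translates of
  \<open>F\<close> fixes the second coordinate along \<open>H\<close> and the first along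
  \<open>W\<close> up to a bounded error; the third remains free.\<close>

lemma is_minor_if_disjoint_lines:
  fixes M :: "nat pair_pre_digraph"
  assumes M: "pair_graph M"
    and H: "conn_on E H" "H \<subseteq> V" "H \<noteq> {}" "\<And>i x. x \<in> H \<Longrightarrow> act i 0 0 x \<in> H"
    and W: "conn_on E W" "W \<subseteq> V" "W \<noteq> {}" "\<And>j x. x \<in> W \<Longrightarrow> act 0 j 0 x \<in> W"
    and F: "finite F" "F \<subseteq> V" "H \<subseteq> (\<Union>i k. act i 0 k ` F)" "W \<subseteq> (\<Union>j k. act 0 j k ` F)"
    and disj: "\<And>j. act 0 j 0 ` H \<inter> W = {}"
  shows "is_minor M \<Gamma>"
proof -
  obtain h w where hw: "h \<in> H" "w \<in> W" using H(3) W(3) by blast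
  have "\<exists>R. finite R \<and> {h, w} \<subseteq> R \<and> R \<subseteq> V \<and> R \<noteq> {} \<and> conn_on E R"
    using hw H(2) W(2) by (intro conn_on_finite_subset sym_E conn nonempty) auto
  then obtain R where R: "finite R" "h \<in> R" "w \<in> R" "R \<subseteq> V" "conn_on E R" by blast
  have "finite (F \<union> R)" "F \<union> R \<subseteq> V" using F R by auto
  from displacement_bound[OF this] obtain N where N: "N > 0"
      "\<forall>x\<in>F \<union> R. \<forall>y\<in>F \<union> R. \<forall>i j k. act i j k x = y \<longrightarrow> \<bar>i\<bar> < N \<and> \<bar>j\<bar> < N"
    by (elim exE conjE)
  have same: "\<bar>i - i'\<bar> < N \<and> \<bar>j - j'\<bar> < N"
    if "act i j k x = act i' j' k' y" "x \<in> F \<union> R" "y \<in> F \<union> R" for i j k i' j' k' x y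
    using N(2)[rule_format, of x y "i - i'" "j - j'" "k - k'"] that by (simp add: act_eq_iff)
  have scale: "m = n" if "\<bar>N * int m - N * int n\<bar> < N" for m n
  proof (rule ccontr)
    assume "m \<noteq> n"
    then have "1 \<le> \<bar>int m - int n\<bar>" by linarith
    then have "N * 1 \<le> N * \<bar>int m - int n\<bar>" using N(1) by (intro mult_left_mono) auto
    also have "\<dots> = \<bar>N * int m - N * int n\<bar>"
      using N(1) by (simp add: abs_mult right_diff_distrib[symmetric])
    finally show False using that by simp
  qed
  define HH where "HH i = act 0 (N * int i) 0 ` H" for i
  define WW where "WW j = act (N * int j) 0 0 ` W" for j
  \<comment> \<open>The bridge at the crossing of \<open>HH i\<close> and \<open>WW j\<close>; the
    horizontal displacement comes from \<open>j\<close>, the vertical one from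
    \<open>i\<close>.\<close>
  define RR where "RR i j = act (N * int j) (N * int i) 0 ` R" for i j
  have HHE: "\<exists>a k x. p = act a (N * int i) k x \<and> x \<in> F \<union> R" if p: "p \<in> HH i" for p i
  proof -
    obtain y where y: "p = act 0 (N * int i) 0 y" "y \<in> H" using p by (auto simp: HH_def)
    then obtain a k x where "y = act a 0 k x" "x \<in> F" using F(3) by blast
    then show ?thesis using y by (auto simp: act_act)
  qed
  have WWE: "\<exists>b k x. p = act (N * int j) b k x \<and> x \<in> F \<union> R" if p: "p \<in> WW j" for p j
  proof -
    obtain y where y: "p = act (N * int j) 0 0 y" "y \<in> W" using p by (auto simp: WW_def)
    then obtain b k x where "y = act 0 b k x" "x \<in> F" using F(4) by blast
    then show ?thesis using y by (auto simp: act_act)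
  qed
  have RRE: "\<exists>k x. p = act (N * int j) (N * int i) k x \<and> x \<in> F \<union> R" if "p \<in> RR i j" for p i j
    using that by (auto simp: RR_def)
  have HH: "i = i'" if "p \<in> HH i" "p \<in> HH i'" for p i i'
    using HHE[OF that(1)] HHE[OF that(2)] same scale by metis
  have WW: "j = j'" if "p \<in> WW j" "p \<in> WW j'" for p j j'
    using WWE[OF that(1)] WWE[OF that(2)] same scale by metis
  have HR: "i = i'" if "p \<in> HH i" "p \<in> RR i' j" for p i i' j
    using HHE[OF that(1)] RRE[OF that(2)] same scale by metis
  have WR: "j = j'" if "p \<in> WW j" "p \<in> RR i j'" for p i j j'
    using WWE[OF that(1)] RRE[OF that(2)] same scale by metis
  have RR: "i = i' \<and> j = j'" if "p \<in> RR i j" "p \<in> RR i' j'" for p i i' j j'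
    using RRE[OF that(1)] RRE[OF that(2)] same scale by metis
  \<comment> \<open>Moving \<open>WW j\<close> back onto \<open>W\<close> is a horizontal
    translation, which maps \<open>H\<close> into itself; so the hypothesis on vertical translates
    of \<open>H\<close> suffices.\<close>
  have HW: "HH i \<inter> WW j = {}" for i j
  proof (rule ccontr)
    assume "HH i \<inter> WW j \<noteq> {}"
    then obtain x y where xy: "x \<in> H" "y \<in> W" "act 0 (N * int i) 0 x = act (N * int j) 0 0 y"
      by (auto simp: HH_def WW_def)
    then have "y = act 0 (N * int i) 0 (act (- (N * int j)) 0 0 x)"
      by (simp add: act_eq_iff act_act)
    then show False using disj[of "N * int i"] H(4)[OF xy(1)] xy(2) by blast
  qed
  have HR_meet: "HH i \<inter> RR i j \<noteq> {}" for i j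
  proof -
    have "act (N * int j) (N * int i) 0 h = act 0 (N * int i) 0 (act (N * int j) 0 0 h)"
      by (simp add: act_act)
    then show ?thesis using H(4)[OF hw(1), of "N * int j"] R(2) by (auto simp: HH_def RR_def)
  qed
  have WR_meet: "WW j \<inter> RR i j \<noteq> {}" for i j
  proof -
    have "act (N * int j) (N * int i) 0 w = act (N * int j) 0 0 (act 0 (N * int i) 0 w)"
      by (simp add: act_act)
    then show ?thesis using W(4)[OF hw(2), of "N * int i"] R(3) by (auto simp: WW_def RR_def)
  qed
  \<comment> \<open>The diagonal bridges make each \<open>B i\<close> connected, and the
    off-diagonal \<open>RR i j\<close> serve as links: such a bridge meets no horizontal line but
    \<open>HH i\<close> and no vertical line but \<open>WW j\<close>.\<close>
  define B where "B i = HH i \<union> RR i i \<union> WW i" for i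
  show ?thesis
  proof (rule is_minor_if_linked_conn_on[OF graph M, where B = B and R = RR])
    fix i :: nat
    have "conn_on E (HH i \<union> RR i i)"
      using HR_meet[of i i] unfolding HH_def RR_def by (intro conn_on_Un conn_on_act_image H R)
    moreover have "conn_on E (WW i)" unfolding WW_def by (intro conn_on_act_image W)
    moreover have "(HH i \<union> RR i i) \<inter> WW i \<noteq> {}" using WR_meet[of i i] by blast
    ultimately show "conn_on E (B i)" unfolding B_def by (rule conn_on_Un)
    show "B i \<noteq> {}" using HR_meet[of i i] by (auto simp: B_def)
    show "B i \<subseteq> V" using H(2) W(2) R(4) act_in by (auto simp: B_def HH_def WW_def RR_def)
  next
    fix i j :: nat assume "i < j"
    show "conn_on E (RR i j)" unfolding RR_def by (intro conn_on_act_image R)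
    show "RR i j \<subseteq> V" using R(4) act_in by (auto simp: RR_def)
    show "B i \<inter> RR i j \<noteq> {}" using HR_meet[of i j] by (auto simp: B_def)
    show "RR i j \<inter> B j \<noteq> {}" using WR_meet[of j i] by (auto simp: B_def)
  next
    fix i j :: nat assume "i \<noteq> j"
    then have False if "p \<in> B i" "p \<in> B j" for p
      using that HH[of p i j] WW[of p i j] HR[of p i j j] HR[of p j i i] WR[of p i j j] WR[of p j i i]
        RR[of p i i j j] HW[of i j] HW[of j i] by (auto simp: B_def)
    then show "B i \<inter> B j = {}" by blast
  next
    fix i j k :: nat assume "i < j" "k \<noteq> i" "k \<noteq> j"
    then have False if "p \<in> RR i j" "p \<in> B k" for p
      using that HR[of p k i j] WR[of p k i j] RR[of p i j k k] by (auto simp: B_def)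
    then show "RR i j \<inter> B k = {}" by blast
  next
    fix i j k l :: nat assume "(i, j) \<noteq> (k, l)"
    then show "RR i j \<inter> RR k l = {}" using RR by blast
  qed
qed

section \<open>Lines built from shortest walks\<close>

lemma relpow_act:
  assumes "(x, y) \<in> E ^^ n"
  shows "(act i j k x, act i j k y) \<in> E ^^ n"
proof -
  obtain f where "f 0 = x" "f n = y" "\<forall>m<n. (f m, f (Suc m)) \<in> E"
    using assms by (auto simp: relpow_fun_conv)
  then show ?thesis
    unfolding relpow_fun_conv by (intro exI[of _ "act i j k \<circ> f"]) (simp add: act_edge)
qed

lemma ex_relpow:
  assumes "x \<in> V" "y \<in> V"
  shows "\<exists>n. (x, y) \<in> E ^^ n"
  using rtrancl_on_rtranclI[OF conn_onD[OF conn assms]] by (simp add: rtrancl_power)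

lemma edge_in: "(x, y) \<in> E \<Longrightarrow> y \<in> V"
  using graph by (auto simp: pair_bidirected_digraph_def pair_sym_digraph_def pair_wf_digraph_def)

lemma walk_in:
  assumes "f 0 \<in> V" "\<forall>m<n. (f m, f (Suc m)) \<in> E" "m \<le> n"
  shows "f m \<in> V"
proof (cases m)
  case (Suc i)
  then show ?thesis using assms(2,3) edge_in[of "f i" "f m"] by simp
qed (use assms(1) in simp)

text \<open>\<open>F\<close> is the vertex set of a shortest walk from some \<open>v\<close> to some
  \<open>act n 0 k v\<close> with \<open>n \<noteq> 0\<close>, and \<open>H\<close> is its periodic
  continuation. If \<open>H\<close> met its shift, there would be a shorter walk of this kind or a
  fixed point of the shift.\<close>

lemma disjoint_shifted_line:
  assumes shift: "\<forall>x\<in>V. act 0 0 1 x \<noteq> x"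
  shows "\<exists>n k F H. n \<noteq> 0 \<and> finite F \<and> F \<subseteq> V \<and> F \<noteq> {} \<and> H = (\<Union>i. act (n * i) 0 (k * i) ` F) \<and>
    conn_on E H \<and> H \<inter> act 0 0 1 ` H = {}"
proof -
  \<comment> \<open>Start point, \<open>n\<close> and \<open>k\<close> all vary in the minimisation,
    since the competing walks below change each of them.\<close>
  define P where "P l \<longleftrightarrow> (\<exists>v\<in>V. \<exists>n k. n \<noteq> 0 \<and> (v, act n 0 k v) \<in> E ^^ l)" for l
  obtain u where "u \<in> V" using nonempty by blast
  then obtain l0 where "(u, act 1 0 0 u) \<in> E ^^ l0" using ex_relpow act_in by blast
  then have "P l0" unfolding P_def using \<open>u \<in> V\<close> zero_neq_one by metis
  define l where "l = (LEAST l. P l)"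
  have "P l" unfolding l_def using \<open>P l0\<close> by (rule LeastI)
  then obtain v n k where v: "v \<in> V" "n \<noteq> 0" "(v, act n 0 k v) \<in> E ^^ l"
    by (auto simp: P_def)
  have least: "l \<le> m" if "u \<in> V" "n' \<noteq> 0" "(u, act n' 0 k' u) \<in> E ^^ m" for u n' k' m
    unfolding l_def by (rule Least_le) (use that P_def in blast)
  obtain f where f: "f 0 = v" "f l = act n 0 k v" "\<forall>m<l. (f m, f (Suc m)) \<in> E"
    using v(3) by (auto simp: relpow_fun_conv)
  have fV: "f m \<in> V" if "m \<le> l" for m using walk_in[OF _ f(3) that] f(1) v(1) by simp
  have shift': "act 0 0 e x \<noteq> x" if "x \<in> V" "\<bar>e\<bar> = 1" for e x
  proof
    assume eq: "act 0 0 e x = x"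
    have "e = 1 \<or> e = - 1" using that(2) by linarith
    then have "act 0 0 1 x = x" using eq act_eq_iff[of 0 0 0 x 0 0 1 x] by (auto simp: act_0)
    then show False using shift that(1) by blast
  qed
  \<comment> \<open>A common point of \<open>H\<close> and its shift relates two walk points by
    \<open>d\<close> periods and one shift. Both signs of \<open>e\<close> are needed because
    \<open>s \<le> t\<close> is arranged by exchanging the two points.\<close>
  have no_return: False
    if "s \<le> t" "t \<le> l" "\<bar>e\<bar> = 1" "act (n * d) 0 (k * d + e) (f s) = f t" for s t d e
  proof (cases "d = 0")
    case False
    \<comment> \<open>The segment from \<open>f s\<close> to \<open>f t\<close> competes with the
      whole walk, so it must be the whole walk; then \<open>d = 1\<close> and the shift fixes
      \<open>v\<close>.\<close>
    have "(f s, act (n * d) 0 (k * d + e) (f s)) \<in> E ^^ (t - s)"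
      using relpow_subwalk[OF f(3) that(1,2)] that(4) by simp
    moreover have "n * d \<noteq> 0" using False v(2) by simp
    ultimately have "l \<le> t - s" using least[OF fV] that(1,2) by (meson order_trans)
    then have "s = 0" "t = l" using that(1,2) False fV by auto
    then have eq: "act (n * d) 0 (k * d + e) v = act n 0 k v" using that(4) f by simp
    from free_coords_unique[OF v(1) eq] have "d = 1" using v(2) by simp
    then have "act 0 0 e v = v" using eq by (simp add: act_eq_iff)
    then show False using shift'[OF v(1) that(3)] by blast
  next
    case True
    then have eq: "act 0 0 e (f s) = f t" using that(4) by simp
    have "f s \<in> V" using fV that(1,2) by simp
    then have "s \<noteq> t" using shift' that(3) eq by metis
    \<comment> \<open>Splicing: walk to \<open>f s\<close>, then follow the tail after
      \<open>f t\<close> translated by \<open>- e\<close>. This skips \<open>t - s > 0\<close>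
      steps.\<close>
    have "(act 0 0 (- e) (f t), act 0 0 (- e) (f l)) \<in> E ^^ (l - t)"
      by (intro relpow_act relpow_subwalk[OF f(3)]) (use that(2) in auto)
    moreover have "act 0 0 (- e) (f t) = f s" using eq[symmetric] by (simp add: act_act act_0)
    moreover have "act 0 0 (- e) (f l) = act n 0 (k - e) v" by (simp add: f(2) act_act)
    moreover have "(v, f s) \<in> E ^^ s" using relpow_subwalk[OF f(3), of 0 s] that(1,2) f(1) by simp
    ultimately have "(v, act n 0 (k - e) v) \<in> E ^^ (s + (l - t))"
      by (auto simp: relpow_add)
    then have "l \<le> s + (l - t)" using least v by blast
    then show False using that(1,2) \<open>s \<noteq> t\<close> by linarith
  qed
  define F where "F = f ` {..l}"
  define H where "H = (\<Union>i. act (n * i) 0 (k * i) ` F)"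
  have "conn_on E H"
    unfolding H_def
  proof (rule conn_on_chain[OF sym_E])
    fix i :: int
    show "conn_on E (act (n * i) 0 (k * i) ` F)"
      unfolding F_def by (intro conn_on_act_image conn_on_walk sym_E) (use f(3) in blast)
    have "act (n * i) 0 (k * i) (f l) = act (n * (i + 1)) 0 (k * (i + 1)) (f 0)"
      by (simp add: f(1,2) act_act algebra_simps)
    then show "act (n * i) 0 (k * i) ` F \<inter> act (n * (i + 1)) 0 (k * (i + 1)) ` F \<noteq> {}"
      unfolding F_def by (metis IntI atMost_iff empty_iff imageI le0 order_refl)
  qed
  moreover have "H \<inter> act 0 0 1 ` H = {}"
  proof (rule ccontr)
    assume "H \<inter> act 0 0 1 ` H \<noteq> {}"
    then obtain p where p: "p \<in> H" "p \<in> act 0 0 1 ` H" by blast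
    obtain i s where "s \<le> l" "p = act (n * i) 0 (k * i) (f s)"
      using p(1) by (auto simp: H_def F_def)
    moreover obtain j t where "t \<le> l" "p = act 0 0 1 (act (n * j) 0 (k * j) (f t))"
      using p(2) by (auto simp: H_def F_def)
    ultimately have st: "s \<le> l" "t \<le> l"
        "act (n * i) 0 (k * i) (f s) = act 0 0 1 (act (n * j) 0 (k * j) (f t))"
      by simp_all
    then have "act (n * (i - j)) 0 (k * (i - j) + - 1) (f s) = f t"
      by (simp add: act_act act_eq_iff algebra_simps)
    moreover have "act (n * (j - i)) 0 (k * (j - i) + 1) (f t) = f s"
      using st(3)[symmetric] by (simp add: act_act act_eq_iff algebra_simps)
    ultimately show False
      using no_return[of s t "- 1" "i - j"] no_return[of t s 1 "j - i"] st(1,2)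
      by (cases "s \<le> t") auto
  qed
  moreover have "finite F" "F \<noteq> {}" "F \<subseteq> V" using fV by (auto simp: F_def)
  ultimately show ?thesis using v(2) H_def by blast
qed

text \<open>A shortest walk between tracks of different levels, closed up inside the track where it
  ends, is repeated periodically to give \<open>W\<close>. All contacts of \<open>W\<close> with
  tracks lie in the translates of \<open>H\<close> by multiples of \<open>(0, d, k)\<close>, and
  these miss the same translates of the shifted line \<open>H'\<close>.\<close>

lemma is_minor_if_separated_tracks:
  fixes M :: "nat pair_pre_digraph"
  assumes M: "pair_graph M"
    and H: "conn_on E H" "H \<subseteq> V" "H \<noteq> {}" "\<And>i x. x \<in> H \<Longrightarrow> act i 0 0 x \<in> H"
    and F: "finite F" "F \<subseteq> V" "H \<subseteq> (\<Union>i. act i 0 0 ` F)"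
    and shift: "H \<inter> act 0 0 1 ` H = {}"
    and sep: "\<And>x y j k. x \<in> H \<Longrightarrow> y \<in> H \<Longrightarrow> act 0 j k x = y \<Longrightarrow> j = 0"
  shows "is_minor M \<Gamma>"
proof -
  define P where "P l \<longleftrightarrow> (\<exists>x\<in>H. \<exists>y\<in>H. \<exists>d k. d \<noteq> 0 \<and> (x, act 0 d k y) \<in> E ^^ l)" for l
  obtain h where h: "h \<in> H" using H(3) by blast
  then obtain l0 where "(h, act 0 1 0 h) \<in> E ^^ l0" using ex_relpow act_in H(2) by blast
  then have "P l0" unfolding P_def using h zero_neq_one by metis
  define l where "l = (LEAST l. P l)"
  have "P l" unfolding l_def using \<open>P l0\<close> by (rule LeastI)
  then obtain x y d k where xy: "x \<in> H" "y \<in> H" "d \<noteq> 0" "(x, act 0 d k y) \<in> E ^^ l"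
    by (auto simp: P_def)
  have least: "l \<le> m" if "u \<in> H" "w \<in> H" "d' \<noteq> 0" "(u, act 0 d' k' w) \<in> E ^^ m" for u w d' k' m
    unfolding l_def by (rule Least_le) (use that P_def in blast)
  obtain f where f: "f 0 = x" "f l = act 0 d k y" "\<forall>m<l. (f m, f (Suc m)) \<in> E"
    using xy(4) by (auto simp: relpow_fun_conv)
  \<comment> \<open>By minimality: a contact at level 0 makes the remaining walk a competitor, and a
    contact at any other level makes the initial segment one.\<close>
  have on_track: "if j = 0 then s = 0 else s = l"
    if "s \<le> l" "z \<in> H" "f s = act 0 j k' z" for s z j k'
  proof (cases "j = 0")
    case True
    have "(act 0 0 (- k') (f s), act 0 0 (- k') (f l)) \<in> E ^^ (l - s)"
      by (intro relpow_act relpow_subwalk[OF f(3)]) (use that(1) in auto)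
    then have "(z, act 0 d (k - k') y) \<in> E ^^ (l - s)"
      using that(3) True f(2) by (simp add: act_act act_0)
    then have "l \<le> l - s" using least that(2) xy by blast
    then show ?thesis using that(1) True by simp
  next
    case False
    have "(x, act 0 j k' z) \<in> E ^^ s"
      using relpow_subwalk[OF f(3), of 0 s] that(1,3) f(1) by simp
    then have "l \<le> s" using least that(2) xy(1) False by blast
    then show ?thesis using that(1) False by simp
  qed
  \<comment> \<open>The walk ends at the translate of \<open>y\<close>, but a periodic continuation
    must reach the translate of \<open>x\<close>; \<open>Q\<close> joins the two inside their
    track.\<close>
  have "\<exists>Q. finite Q \<and> {act 0 d k x, act 0 d k y} \<subseteq> Q \<and> Q \<subseteq> act 0 d k ` H \<and> Q \<noteq> {} \<and> conn_on E Q"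
    using xy H(1) by (intro conn_on_finite_subset sym_E conn_on_act_image) auto
  then obtain Q where Q: "finite Q" "act 0 d k x \<in> Q" "act 0 d k y \<in> Q" "Q \<subseteq> act 0 d k ` H"
      "conn_on E Q"
    by blast
  define Y where "Y = f ` {..l} \<union> Q"
  have xY: "x \<in> Y" "act 0 d k x \<in> Y" using f(1) Q(2) by (auto simp: Y_def)
  have "conn_on E Y"
    unfolding Y_def
  proof (rule conn_on_Un[OF conn_on_walk[OF sym_E] Q(5)])
    show "f ` {..l} \<inter> Q \<noteq> {}" using f(2) Q(3) by (metis IntI atMost_iff empty_iff imageI order_refl)
  qed (use f(3) in blast)
  have "f ` {..l} \<subseteq> V" using walk_in[OF _ f(3)] f(1) xy(1) H(2) by auto
  moreover have "Q \<subseteq> V" using Q(4) H(2) act_in by blast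
  ultimately have YV: "Y \<subseteq> V" by (simp add: Y_def)
  have "finite Y" using Q(1) by (simp add: Y_def)
  \<comment> \<open>\<open>on_track\<close> handles the walk, and \<open>sep\<close> identifies the
    level of \<open>Q\<close>. Levels that are multiples of \<open>d\<close> suffice, since the
    vertical period is \<open>(0, d, k)\<close>.\<close>
  have Y_track: "i = 0 \<and> act 0 0 k' z = x \<or> i = 1 \<and> act 0 d k' z \<in> act 0 d k ` H"
    if yz: "act 0 (d * i) k' z \<in> Y" "z \<in> H" for i k' z
  proof -
    consider (walk) s where "s \<le> l" "f s = act 0 (d * i) k' z"
      | (track) "act 0 (d * i) k' z \<in> act 0 d k ` H"
      using yz(1) Q(4) by (auto simp: Y_def)
    then have "i = 0 \<and> act 0 0 k' z = x \<or> act 0 (d * i) k' z \<in> act 0 d k ` H"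
    proof cases
      case walk
      show ?thesis
      proof (cases "i = 0")
        case True
        then show ?thesis using on_track[OF walk(1) yz(2) walk(2)] walk(2) f(1) by simp
      next
        case False
        then have "s = l" using on_track[OF walk(1) yz(2) walk(2)] xy(3) by simp
        then show ?thesis using walk(2) f(2) xy(2) by (metis imageI)
      qed
    qed auto
    moreover have "i = 1" if tr: "act 0 (d * i) k' z \<in> act 0 d k ` H"
    proof -
      obtain w where w: "w \<in> H" "act 0 (d * i) k' z = act 0 d k w" using tr by blast
      then have "act 0 (d * i - d) (k' - k) z = w" by (simp add: act_eq_iff)
      from sep[OF yz(2) w(1) this] have "d * i = d" by simp
      then show ?thesis using xy(3) by simp
    qed
    ultimately show ?thesis by auto
  qed
  define W where "W = (\<Union>i. act 0 (d * i) (k * i) ` Y)"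
  define H' where "H' = act 0 0 1 ` H"
  \<comment> \<open>The second unit vector now acts as \<open>act 0 d k\<close>, the period of
    \<open>W\<close>.\<close>
  interpret A: lattice_graph \<Gamma> "\<lambda>i j k'. act (1 * i) (d * j) (k' + 0 * i + k * j)"
    by (rule lattice_graph_reparametrise) (use xy(3) in auto)
  show ?thesis
  proof (rule A.is_minor_if_disjoint_lines[OF M, where H = H' and W = W and F = "F \<union> Y"])
    show "conn_on E H'" unfolding H'_def by (intro conn_on_act_image H)
    show "H' \<subseteq> V" "H' \<noteq> {}" using H(2,3) act_in by (auto simp: H'_def)
    show "act (1 * i) (d * 0) (0 + 0 * i + k * 0) x \<in> H'" if x: "x \<in> H'" for i x
    proof -
      obtain z where z: "z \<in> H" "x = act 0 0 1 z" using x by (auto simp: H'_def)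
      have "act i 0 0 x = act 0 0 1 (act i 0 0 z)" by (simp add: z(2) act_act)
      then show ?thesis using H(4)[OF z(1)] by (auto simp: H'_def)
    qed
    show "conn_on E W"
      unfolding W_def
    proof (rule conn_on_chain[OF sym_E])
      fix i :: int
      show "conn_on E (act 0 (d * i) (k * i) ` Y)" by (rule conn_on_act_image[OF \<open>conn_on E Y\<close>])
      have "act 0 (d * i) (k * i) (act 0 d k x) = act 0 (d * (i + 1)) (k * (i + 1)) x"
        by (simp add: act_act algebra_simps)
      then show "act 0 (d * i) (k * i) ` Y \<inter> act 0 (d * (i + 1)) (k * (i + 1)) ` Y \<noteq> {}"
        using xY by (metis IntI empty_iff imageI)
    qed
    show "W \<subseteq> V" "W \<noteq> {}" using YV act_in xY by (auto simp: W_def)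
    show "act (1 * 0) (d * j) (0 + 0 * 0 + k * j) x \<in> W" if x: "x \<in> W" for j x
    proof -
      obtain i z where z: "z \<in> Y" "x = act 0 (d * i) (k * i) z" using x by (auto simp: W_def)
      have "act 0 (d * j) (k * j) x = act 0 (d * (j + i)) (k * (j + i)) z"
        by (simp add: z(2) act_act algebra_simps)
      then show ?thesis using z(1) by (auto simp: W_def)
    qed
    show "finite (F \<union> Y)" "F \<union> Y \<subseteq> V" using F \<open>finite Y\<close> YV by auto
    show "H' \<subseteq> (\<Union>i k'. act (1 * i) (d * 0) (k' + 0 * i + k * 0) ` (F \<union> Y))"
    proof
      fix x assume "x \<in> H'"
      then obtain z where z: "z \<in> H" "x = act 0 0 1 z" by (auto simp: H'_def)
      then obtain i w where "w \<in> F" "z = act i 0 0 w" using F(3) by blast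
      then have "w \<in> F \<union> Y" "x = act (1 * i) (d * 0) (1 + 0 * i + k * 0) w"
        using z(2) by (auto simp: act_act)
      then show "x \<in> (\<Union>i k'. act (1 * i) (d * 0) (k' + 0 * i + k * 0) ` (F \<union> Y))" by blast
    qed
    show "W \<subseteq> (\<Union>j k'. act (1 * 0) (d * j) (k' + 0 * 0 + k * j) ` (F \<union> Y))"
    proof
      fix x assume "x \<in> W"
      then obtain j w where "w \<in> Y" "x = act 0 (d * j) (k * j) w" by (auto simp: W_def)
      then have "w \<in> F \<union> Y" "x = act (1 * 0) (d * j) (0 + 0 * 0 + k * j) w" by auto
      then show "x \<in> (\<Union>j k'. act (1 * 0) (d * j) (k' + 0 * 0 + k * j) ` (F \<union> Y))" by blast
    qed
    show "act (1 * 0) (d * j) (0 + 0 * 0 + k * j) ` H' \<inter> W = {}" for j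
    proof (rule ccontr)
      assume "act (1 * 0) (d * j) (0 + 0 * 0 + k * j) ` H' \<inter> W \<noteq> {}"
      then obtain z i w where z: "z \<in> H" "w \<in> Y"
          "act 0 (d * j) (k * j) (act 0 0 1 z) = act 0 (d * i) (k * i) w"
        by (auto simp: H'_def W_def)
      then have w: "w = act 0 (d * (j - i)) (k * (j - i) + 1) z"
        by (simp add: act_act act_eq_iff algebra_simps)
      \<comment> \<open>Either case places the shift of a point of \<open>H\<close> in
        \<open>H\<close>, contrary to \<open>shift\<close>.\<close>
      from Y_track[of "j - i" "k * (j - i) + 1" z] z(1,2) w
      consider "j - i = 0" "act 0 0 1 z = x" | u where "j - i = 1" "u \<in> H" "act 0 d (k + 1) z = act 0 d k u"
        by auto
      then show False
      proof cases
        case 1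
        then show False using shift z(1) xy(1) by blast
      next
        case 2
        then have "act 0 0 1 z = u" by (simp add: act_eq_iff)
        then show False using shift z(1) 2(2) by blast
      qed
    qed
  qed
qed

lemma is_minor_if_shift_free:
  fixes M :: "nat pair_pre_digraph"
  assumes M: "pair_graph M" and shift: "\<forall>x\<in>V. act 0 0 1 x \<noteq> x"
  shows "is_minor M \<Gamma>"
proof -
  obtain n k F H where n: "n \<noteq> 0" and F: "finite F" "F \<subseteq> V" "F \<noteq> {}"
    and H: "H = (\<Union>i. act (n * i) 0 (k * i) ` F)" and conn_H: "conn_on E H"
    and H_shift: "H \<inter> act 0 0 1 ` H = {}"
    using disjoint_shifted_line[OF shift] by (elim exE conjE)
  obtain N where N: "N > 0"
      "\<forall>x\<in>F. \<forall>y\<in>F. \<forall>i j k. act i j k x = y \<longrightarrow> \<bar>i\<bar> < N \<and> \<bar>j\<bar> < N"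
    using displacement_bound[OF F(1,2)] by (elim exE conjE)
  \<comment> \<open>The first unit vector becomes the period of \<open>H\<close>; levels are spaced
    by \<open>N\<close>, so that different levels are disjoint by the displacement bound.\<close>
  interpret A: lattice_graph \<Gamma> "\<lambda>i j k'. act (n * i) (N * j) (k' + k * i + 0 * j)"
    by (rule lattice_graph_reparametrise) (use n N(1) in auto)
  show ?thesis
  proof (rule A.is_minor_if_separated_tracks[OF M conn_H, where F = F])
    show "H \<subseteq> V" "H \<noteq> {}" using F(2,3) act_in by (auto simp: H)
    show "act (n * i) (N * 0) (0 + k * i + 0 * 0) x \<in> H" if x: "x \<in> H" for i x
    proof -
      obtain j z where z: "z \<in> F" "x = act (n * j) 0 (k * j) z" using x by (auto simp: H)
      have "act (n * i) 0 (k * i) x = act (n * (i + j)) 0 (k * (i + j)) z"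
        by (simp add: z(2) act_act algebra_simps)
      then show ?thesis using z(1) by (auto simp: H)
    qed
    show "finite F" "F \<subseteq> V" by fact+
    show "H \<subseteq> (\<Union>i. act (n * i) (N * 0) (0 + k * i + 0 * 0) ` F)" by (simp add: H)
    show "H \<inter> act (n * 0) (N * 0) (1 + k * 0 + 0 * 0) ` H = {}" using H_shift by simp
    fix x y j k' assume xy: "x \<in> H" "y \<in> H" "act (n * 0) (N * j) (k' + k * 0 + 0 * j) x = y"
    obtain i z where z: "z \<in> F" "x = act (n * i) 0 (k * i) z" using xy(1) by (auto simp: H)
    obtain i' z' where z': "z' \<in> F" "y = act (n * i') 0 (k * i') z'" using xy(2) by (auto simp: H)
    have "act (n * i) (N * j) (k' + k * i) z = act (n * i') 0 (k * i') z'"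
      using xy(3) z(2) z'(2) by (simp add: act_act)
    then have "\<bar>N * j\<bar> < N"
      using N(2)[rule_format, of z z' "n * i - n * i'" "N * j" "k' + k * i - k * i'"] z(1) z'(1)
      by (simp add: act_eq_iff)
    then show "j = 0" using N(1) by (simp add: abs_mult)
  qed
qed

end

section \<open>The Cayley graph as a lattice graph\<close>

lemma pair_bidirected_digraph_cayley_graph:
  fixes G (structure)
  assumes "group G" and S: "S \<subseteq> carrier G" "\<forall>s\<in>carrier G. s \<in> S \<longleftrightarrow> inv s \<in> S" "\<one> \<notin> S"
  shows "pair_bidirected_digraph (cayley_graph G S)"
proof -
  interpret group G by fact
  show ?thesis
  proof
    show "symmetric (with_proj (cayley_graph G S))"
      unfolding symmetric_def with_proj_simps
    proof (rule symI)
      fix u v assume "(u, v) \<in> parcs (cayley_graph G S)"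
      then obtain s where s: "u \<in> carrier G" "v \<in> carrier G" "s \<in> S" "u = s \<otimes> v"
        by (auto simp: cayley_graph_def)
      then have "s \<in> carrier G" using S(1) by blast
      then have "inv s \<in> S" using s(3) S(2) by blast
      moreover have "v = inv s \<otimes> u" using s \<open>s \<in> carrier G\<close> by (simp add: m_assoc[symmetric])
      ultimately show "(v, u) \<in> parcs (cayley_graph G S)" using s by (auto simp: cayley_graph_def)
    qed
  next
    fix e assume "e \<in> parcs (cayley_graph G S)"
    then obtain s v where s: "e = (s \<otimes> v, v)" "s \<in> S" "v \<in> carrier G"
      by (auto simp: cayley_graph_def)
    then have "s \<in> carrier G" using S(1) by blast
    then have "s \<otimes> v = v \<longleftrightarrow> s = \<one>" using s(3) r_cancel_one by blast
    then show "fst e \<noteq> snd e" using s S(3) by auto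
  qed (auto simp: cayley_graph_def)
qed

text \<open>Edges multiply by generators on the left, so a word for
  \<open>y \<otimes> inv x\<close>, read from right to left, is a walk from \<open>x\<close> to
  \<open>y\<close>.\<close>

lemma conn_on_cayley_graph:
  fixes G (structure)
  assumes "group G" and S: "S \<subseteq> carrier G" "\<forall>s\<in>carrier G. s \<in> S \<longleftrightarrow> inv s \<in> S"
    and gen: "generate G S = carrier G"
  shows "conn_on (parcs (cayley_graph G S)) (pverts (cayley_graph G S))"
proof -
  interpret group G by fact
  let ?E = "parcs (cayley_graph G S)"
  have edge: "(v, s \<otimes> v) \<in> rtrancl_on (carrier G) ?E" if "s \<in> S" "v \<in> carrier G" for s v
  proof -
    have s: "s \<in> carrier G" using that S(1) by blast
    then have "inv s \<in> S" using that(1) S(2) by blast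
    moreover have "v = inv s \<otimes> (s \<otimes> v)" using s that(2) by (simp add: m_assoc[symmetric])
    ultimately have "(v, s \<otimes> v) \<in> ?E" using s that by (auto simp: cayley_graph_def)
    then show ?thesis using s that by (intro rtrancl_on_into_rtrancl_on[OF rtrancl_on_refl]) auto
  qed
  have reach: "\<forall>v\<in>carrier G. (v, g \<otimes> v) \<in> rtrancl_on (carrier G) ?E" if "g \<in> generate G S" for g
    using that
  proof (induction rule: generate.induct)
    case one
    then show ?case by simp
  next
    case (incl s)
    then show ?case using edge by blast
  next
    case (inv s)
    then have "inv s \<in> S" using S by blast
    then show ?case using edge by blast
  next
    case (eng g h)
    then have gh: "g \<in> carrier G" "h \<in> carrier G" using gen by blast+
    show ?case
    proof
      fix v assume v: "v \<in> carrier G"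
      then have "(h \<otimes> v, g \<otimes> (h \<otimes> v)) \<in> rtrancl_on (carrier G) ?E" using eng.IH(1) gh by simp
      then show "(v, g \<otimes> h \<otimes> v) \<in> rtrancl_on (carrier G) ?E"
        using rtrancl_on_trans[OF bspec[OF eng.IH(2) v]] v gh by (simp add: m_assoc)
    qed
  qed
  have "(x, y) \<in> rtrancl_on (carrier G) ?E" if "x \<in> carrier G" "y \<in> carrier G" for x y
  proof -
    have "y \<otimes> inv x \<in> generate G S" using that gen by simp
    from reach[OF this] that(1) have "(x, (y \<otimes> inv x) \<otimes> x) \<in> rtrancl_on (carrier G) ?E" by blast
    then show ?thesis using that by (simp add: m_assoc)
  qed
  then show ?thesis by (simp add: conn_on_def cayley_graph_def)
qed

theorem corollary3p5:
  fixes C :: "('c, 'd) monoid_scheme"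
    and G :: "('a, 'b) monoid_scheme"
    and S :: "'a set"
  assumes "group C" and "cyclic_group C" and "\<not> trivial_group C"
    and "finitely_generated_group G"
    and "\<exists>H. subgroup H G \<and> (integer_group \<times>\<times> integer_group) \<times>\<times> C \<cong> G\<lparr>carrier := H\<rparr>"
    and "finite S" and "S \<subseteq> carrier G" and "generate G S = carrier G"
    and "\<forall>s\<in>carrier G. s \<in> S \<longleftrightarrow> inv\<^bsub>G\<^esub> s \<in> S"
    and "\<one>\<^bsub>G\<^esub> \<notin> S"
  shows "\<not> minor_excluded (cayley_graph G S)"
proof -
  interpret C: group C by fact
  interpret G: group G using assms(4) by (simp add: finitely_generated_group_def)
  let ?A = "(integer_group \<times>\<times> integer_group) \<times>\<times> C"
  obtain H \<psi> where H: "subgroup H G" and \<psi>: "\<psi> \<in> iso ?A (G\<lparr>carrier := H\<rparr>)"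
    using assms(5) by (auto simp: is_iso_def)
  have \<psi>_in: "\<psi> x \<in> carrier G" if "x \<in> carrier ?A" for x
    using that \<psi> subgroup.subset[OF H] by (auto simp: iso_def bij_betw_def)
  have \<psi>_mult: "\<psi> (x \<otimes>\<^bsub>?A\<^esub> y) = \<psi> x \<otimes>\<^bsub>G\<^esub> \<psi> y" if "x \<in> carrier ?A" "y \<in> carrier ?A" for x y
    using hom_mult[OF iso_imp_homomorphism[OF \<psi>] that] by simp
  have \<psi>_inj: "inj_on \<psi> (carrier ?A)" using \<psi> by (simp add: iso_def bij_betw_def)
  obtain c where c: "c \<in> carrier C" "c \<noteq> \<one>\<^bsub>C\<^esub>"
    using assms(1,3) C.one_closed by (auto simp: trivial_group_def)
  define t where "t i j k = \<psi> ((i, j), c [^]\<^bsub>C\<^esub> k)" for i j k :: int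
  have t_in: "t i j k \<in> carrier G" for i j k
    unfolding t_def using c by (intro \<psi>_in) simp
  have t_mult: "t i j k \<otimes>\<^bsub>G\<^esub> t i' j' k' = t (i + i') (j + j') (k + k')" for i j k i' j' k'
    unfolding t_def using c by (subst \<psi>_mult[symmetric]) (simp_all add: C.int_pow_mult)
  have t_0: "t 0 0 0 = \<one>\<^bsub>G\<^esub>"
    using t_mult[of 0 0 0 0 0 0] t_in[of 0 0 0] by (simp add: G.l_cancel_one)
  have t_eq_one: "i = 0 \<and> j = 0 \<and> c [^]\<^bsub>C\<^esub> k = \<one>\<^bsub>C\<^esub>" if "t i j k = \<one>\<^bsub>G\<^esub>" for i j k
  proof -
    have "\<psi> ((i, j), c [^]\<^bsub>C\<^esub> k) = \<psi> ((0, 0), c [^]\<^bsub>C\<^esub> (0::int))"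
      using that t_0 by (simp add: t_def)
    then show ?thesis using inj_onD[OF \<psi>_inj] c by force
  qed
  \<comment> \<open>Right multiplication preserves edges, which are left multiplications. Outside
    the group \<open>act\<close> is the identity because the laws of an action are required at every
    point of the type.\<close>
  define act where "act i j k x = (if x \<in> carrier G then x \<otimes>\<^bsub>G\<^esub> t i j k else x)" for i j k x
  have fix_iff: "act i j k x = x \<longleftrightarrow> t i j k = \<one>\<^bsub>G\<^esub>" if "x \<in> carrier G" for i j k x
    using that t_in G.l_cancel_one by (simp add: act_def)
  interpret lattice_graph "cayley_graph G S" act
  proof (rule lattice_graph.intro)
    show "pair_bidirected_digraph (cayley_graph G S)"
      by (rule pair_bidirected_digraph_cayley_graph[OF G.is_group assms(7,9,10)])
    show "conn_on (parcs (cayley_graph G S)) (pverts (cayley_graph G S))"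
      by (rule conn_on_cayley_graph[OF G.is_group assms(7,9,8)])
    show "pverts (cayley_graph G S) \<noteq> {}" using G.one_closed by (auto simp: cayley_graph_def)
    show "act i j k x \<in> pverts (cayley_graph G S)" if "x \<in> pverts (cayley_graph G S)" for i j k x
      using that t_in by (simp add: cayley_graph_def act_def)
    show "act 0 0 0 x = x" for x by (simp add: act_def t_0)
    show "act i j k (act i' j' k' x) = act (i + i') (j + j') (k + k') x" for i j k i' j' k' x
      using t_in by (simp add: act_def G.m_assoc t_mult add.commute)
    show "(act i j k x, act i j k y) \<in> parcs (cayley_graph G S)"
      if xy: "(x, y) \<in> parcs (cayley_graph G S)" for i j k x y
    proof -
      obtain s where "x \<in> carrier G" "y \<in> carrier G" "s \<in> S" "x = s \<otimes>\<^bsub>G\<^esub> y"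
        using xy by (auto simp: cayley_graph_def)
      moreover from this have "s \<in> carrier G" using assms(7) by blast
      ultimately show ?thesis using t_in by (auto simp: cayley_graph_def act_def G.m_assoc)
    qed
    show "i = 0 \<and> j = 0" if "x \<in> pverts (cayley_graph G S)" "act i j k x = x" for i j k x
      using that fix_iff t_eq_one by (simp add: cayley_graph_def)
  qed
  \<comment> \<open>A fixed point would force \<open>c\<close> to be the identity, by injectivity of
    \<open>\<psi>\<close>.\<close>
  have "act 0 0 1 x \<noteq> x" if "x \<in> V" for x
    using that fix_iff t_eq_one[of 0 0 1] c by (auto simp: cayley_graph_def)
  then show ?thesis
    unfolding minor_excluded_def using is_minor_if_shift_free by blast
qed

end
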